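(* Let $D_0=\{(a,b)\in(1/4,1/2)\times(1/2,3/4) : \mathcal J(a,b)\ne\{0,1\}\}$ and, for $a\in(1/4,1/2)$, let $\phi(a)=\sup\{b : \mathcal J(a,b)\neq\{0,1\}\}$, so that $\phi(a)=(\omega_r^+)^\infty$ whenever $a\in\Delta(r)$ for some $r\in\mathbb Q\cap(0,1)$. Then $$D_0=\{(a,b)\in(1/4,1/2)\times(1/2,3/4) : b\le\phi(a)\}.$$
   Context: Doubling map: $T:[0,1]\to[0,1]$, $Tx=2x$ for $x\in[0,1/2]$, $Tx=2x-1$ for $x\in(1/2,1]$. For $0<a<b<1$ put $\mathcal J(a,b)=\{x\in[0,1]: T^nx\notin(a,b)\text{ for all }n\ge0\}$. Words have letters in $\{0,1\}$; $u^\infty=uuu\cdots$, $|u|$ is the length of $u$ and $|u|_1$ the number of 1s. An infinite word $w_1w_2\dots$ is identified with the real number $\sum_{n\ge1}w_n2^{-n}$. A word is balanced if any two of its factors $u,v$ of equal length satisfy $||u|_1-|v|_1|\le1$; a finite word $w$ is cyclically balanced if $w^2$ is balanced. For $r=p/q\in\mathbb Q\cap(0,1)$ in lowest terms, $\omega_r^-$ is the lexicographically largest cyclically balanced word of length $q$ with exactly $p$ ones beginning with 0, and $\omega_r^+$ is the lexicographically smallest cyclically balanced word of length $q$ with exactly $p$ ones beginning with 1. $\Delta(r)=[(\omega_r^-)^\infty,\ \omega_r^-(\omega_r^+)^\infty]$. *)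

theory Defs
  imports Complex_Main "HOL-Library.Stream" "HOL-Library.Sublist" "HOL-Library.List_Lexorder"
begin

definition doubling :: "real \<Rightarrow> real" where
  "doubling x = (if x \<le> 1/2 then 2 * x else 2 * x - 1)"

definition survivor :: "real \<Rightarrow> real \<Rightarrow> real set" where
  "survivor a b = {x \<in> {0..1}. \<forall>n. (doubling ^^ n) x \<notin> {a<..<b}}"

definition balanced :: "nat list \<Rightarrow> bool" where
  "balanced w \<longleftrightarrow> (\<forall>u v. sublist u w \<and> sublist v w \<and> length u = length v
     \<longrightarrow> \<bar>int (count_list u 1) - int (count_list v 1)\<bar> \<le> 1)"

definition cyclically_balanced :: "nat list \<Rightarrow> bool" where
  "cyclically_balanced w \<longleftrightarrow> balanced (w @ w)"

text \<open>For \<open>r = p/q\<close> in lowest terms (\<open>q > 0\<close>), \<open>quotient_of r = (p, q)\<close>.\<close>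

definition cb_words :: "rat \<Rightarrow> nat list set" where
  "cb_words r = {w. set w \<subseteq> {0, 1} \<and> cyclically_balanced w
     \<and> int (length w) = snd (quotient_of r) \<and> int (count_list w 1) = fst (quotient_of r)}"

text \<open>\<open>Max\<close> and \<open>Min\<close> refer to the lexicographic order on lists from \<open>List_Lexorder\<close>;
  they are only used for \<open>0 < r < 1\<close>, where the sets are finite and nonempty.\<close>

definition omega_minus :: "rat \<Rightarrow> nat list" where
  "omega_minus r = Max {w \<in> cb_words r. hd w = 0}"

definition omega_plus :: "rat \<Rightarrow> nat list" where
  "omega_plus r = Min {w \<in> cb_words r. hd w = 1}"

text \<open>The letter \<open>w\<^sub>n\<close>, \<open>n \<ge> 1\<close>, is \<open>w !! (n - 1)\<close>.\<close>

definition word_val :: "nat stream \<Rightarrow> real" where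
  "word_val w = (\<Sum>n. real (w !! n) / 2 ^ Suc n)"

definition Delta :: "rat \<Rightarrow> real set" where
  "Delta r = {word_val (cycle (omega_minus r)) ..
              word_val (omega_minus r @- cycle (omega_plus r))}"

definition D0 :: "(real \<times> real) set" where
  "D0 = {(a, b) \<in> {1/4<..<1/2} \<times> {1/2<..<3/4}. survivor a b \<noteq> {0, 1}}"

text \<open>Holes \<open>(a, b)\<close> are only considered for \<open>0 < a < b < 1\<close>.  The bound \<open>b < 1\<close> matters:
  for \<open>b > 1\<close> the point 1 itself would lie in the hole.\<close>

definition phi :: "real \<Rightarrow> real" where
  "phi a = Sup {b. a < b \<and> b < 1 \<and> survivor a b \<noteq> {0, 1}}"

end

(*
  With H(t) = sum_n floor(t + n r) / 2^(n+1), the lifted doubling map acts on the range of H as the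
  rotation t -> t + r; on t in (1/q)Z this is the periodic orbit of omega_plus^infinity.  In the code
  h j = H(j/q), and omega_plus, omega_minus have values h (q - p), h (q - p - 1) when repeated.
  Extremality of these words comes from the fact that prefix counts of a cyclically balanced word lie
  within 1 of their mean; they turn out to be 10u and 01u with a common u, so that
  omega_minus omega_plus^infinity lies exactly 1/4 below omega_plus^infinity.

  Hence, if a <= omega_minus omega_plus^infinity and b > omega_plus^infinity, a nontrivial surviving
  orbit ends up in the half-circle (h 0, h 0 + 1/2], where its lift is caught between two neighbouring
  points of the rotated orbit.  Doubling expands its distance to the left one, so it must coincide
  with that point and then visit h 0, which is excluded.  The description of D0 only needs that the
  supremum defining phi is attained: surviving orbits stay away from the discontinuity 1/2, so limits
  of survivors survive.
*)

theory Submission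
  imports Defs "HOL-Analysis.Analysis"
begin

section \<open>The lifted rotation by p/q\<close>

locale rotation =
  fixes p q :: int
  assumes p_pos: "0 < p" and p_less: "p < q" and coprime_pq: "coprime p q"
begin

lemma q_pos: "0 < q"
  using p_pos p_less by simp

definition h :: "int \<Rightarrow> real" where
  "h j = (\<Sum>n. real_of_int ((j + int n * p) div q) / 2 ^ Suc n)"

lemma abs_div_le: "\<bar>x div q\<bar> \<le> \<bar>x\<bar>" for x :: int
proof (cases "0 \<le> x")
  case True
  then show ?thesis
    using q_pos zdiv_mono2[of x 1 q] pos_imp_zdiv_nonneg_iff[of q x] by simp
next
  case False
  then show ?thesis
    using q_pos zdiv_mono2_neg[of x 1 q] pos_imp_zdiv_neg_iff[of q x] by simp
qed

text \<open>The floors grow at most linearly in \<open>n\<close>, so a multiple of the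
  differentiated geometric series at 1/2 dominates.\<close>

lemma summable_h: "summable (\<lambda>n. real_of_int ((j + int n * p) div q) / 2 ^ Suc n)"
proof (rule summable_comparison_test)
  have "summable (\<lambda>n. of_nat (Suc n) * (1/2::real) ^ n)"
    using geometric_deriv_sums[of "1/2::real"] by (auto simp: sums_iff)
  then show "summable (\<lambda>n. real_of_int (\<bar>j\<bar> + p) * (of_nat (Suc n) * (1/2::real) ^ n))"
    by (rule summable_mult)
  have "norm (real_of_int ((j + int n * p) div q) / 2 ^ Suc n)
      \<le> real_of_int (\<bar>j\<bar> + p) * (of_nat (Suc n) * (1/2::real) ^ n)" for n
  proof -
    have "\<bar>(j + int n * p) div q\<bar> \<le> \<bar>j + int n * p\<bar>"
      by (rule abs_div_le)
    also have "\<dots> \<le> (\<bar>j\<bar> + p) * int (Suc n)"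
    proof -
      have "\<bar>j + int n * p\<bar> \<le> \<bar>j\<bar> + int n * p"
        using abs_triangle_ineq[of j "int n * p"] p_pos by simp
      also have "\<dots> \<le> \<bar>j\<bar> * int (Suc n) + p * int (Suc n)"
        using p_pos by (intro add_mono) (auto simp: algebra_simps)
      finally show ?thesis by (simp add: algebra_simps)
    qed
    finally have "real_of_int \<bar>(j + int n * p) div q\<bar> \<le> real_of_int ((\<bar>j\<bar> + p) * int (Suc n))"
      by linarith
    then have "\<bar>real_of_int ((j + int n * p) div q)\<bar> \<le> real_of_int (\<bar>j\<bar> + p) * of_nat (Suc n)"
      by simp
    then have "\<bar>real_of_int ((j + int n * p) div q)\<bar> / 2 ^ Suc n
        \<le> real_of_int (\<bar>j\<bar> + p) * of_nat (Suc n) / 2 ^ n"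
      by (intro frac_le) (auto simp: p_pos less_imp_le)
    moreover have "norm (real_of_int ((j + int n * p) div q) / 2 ^ Suc n)
        = \<bar>real_of_int ((j + int n * p) div q)\<bar> / 2 ^ Suc n"
      by (simp only: real_norm_def abs_divide abs_numeral power_abs)
    moreover have "real_of_int (\<bar>j\<bar> + p) * of_nat (Suc n) / 2 ^ n
        = real_of_int (\<bar>j\<bar> + p) * (of_nat (Suc n) * (1/2::real) ^ n)"
      by (simp only: power_one_over times_divide_eq_right mult_1_right)
    ultimately show ?thesis
      by linarith
  qed
  then show "\<exists>N. \<forall>n\<ge>N. norm (real_of_int ((j + int n * p) div q) / 2 ^ Suc n)
      \<le> real_of_int (\<bar>j\<bar> + p) * (of_nat (Suc n) * (1/2::real) ^ n)"
    by blast
qed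

lemma h_mono: "i \<le> j \<Longrightarrow> h i \<le> h j"
  unfolding h_def using q_pos
  by (intro suminf_le summable_h divide_right_mono) (auto intro: zdiv_mono1)

text \<open>Splitting off the term \<open>n = 0\<close> shifts the index of the series. This is the
  semiconjugacy between adding \<open>p\<close> and doubling, with \<open>j div q\<close> as the
  carry.\<close>

lemma h_shift: "h (j + p) = 2 * h j - real_of_int (j div q)"
proof -
  have "h j = (\<Sum>n. real_of_int ((j + int (n + 1) * p) div q) / 2 ^ Suc (n + 1))
      + (\<Sum>n<1. real_of_int ((j + int n * p) div q) / 2 ^ Suc n)"
    unfolding h_def by (rule suminf_split_initial_segment[OF summable_h])
  also have "(\<lambda>n. real_of_int ((j + int (n + 1) * p) div q) / 2 ^ Suc (n + 1))
      = (\<lambda>n. real_of_int ((j + p + int n * p) div q) / 2 ^ Suc n / 2)"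
    by (auto simp: algebra_simps fun_eq_iff)
  also have "(\<Sum>n. real_of_int ((j + p + int n * p) div q) / 2 ^ Suc n / 2) = h (j + p) / 2"
    unfolding h_def by (rule suminf_divide[OF summable_h])
  finally show ?thesis by simp
qed

text \<open>Adding \<open>q\<close> raises every floor by 1, and the weights sum to 1.\<close>

lemma h_add_period: "h (j + q) = h j + 1"
proof -
  have "(\<lambda>n. real_of_int ((j + q + int n * p) div q) / 2 ^ Suc n)
     = (\<lambda>n. real_of_int ((j + int n * p) div q) / 2 ^ Suc n + (1/2) ^ Suc n)"
  proof
    fix n
    have "(j + q + int n * p) div q = (j + int n * p) div q + 1"
      using q_pos div_add_self2[of q "j + int n * p"] by (simp add: algebra_simps)
    then show "real_of_int ((j + q + int n * p) div q) / 2 ^ Suc n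
      = real_of_int ((j + int n * p) div q) / 2 ^ Suc n + (1/2) ^ Suc n"
      by (simp only: of_int_add add_divide_distrib of_int_1 power_one_over)
  qed
  then have "h (j + q) = (\<Sum>n. real_of_int ((j + int n * p) div q) / 2 ^ Suc n + (1/2) ^ Suc n)"
    unfolding h_def by simp
  also have "\<dots> = h j + (\<Sum>n. (1/2) ^ Suc n)"
    unfolding h_def using power_half_series
    by (subst suminf_add[OF summable_h]) (auto simp: sums_iff)
  also have "(\<Sum>n. (1/2::real) ^ Suc n) = 1"
    using power_half_series by (simp add: sums_iff)
  finally show ?thesis .
qed

lemma h_add_periods: "h (j + k * q) = h j + real_of_int k"
proof (induction k rule: int_induct[where k = 0])
  case (step1 i)
  then show ?case using h_add_period[of "j + i * q"] by (simp add: algebra_simps)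
next
  case (step2 i)
  then show ?case using h_add_period[of "j + (i - 1) * q"] by (simp add: algebra_simps)
qed simp

section \<open>Binary digits of the orbit points\<close>

text \<open>The increments of a floor staircase: the mechanical word of slope p/q and intercept
  j/q.\<close>

definition digit :: "int \<Rightarrow> nat \<Rightarrow> int" where
  "digit j i = (j + int (Suc i) * p) div q - (j + int i * p) div q"

lemma digit_cases: "digit j i = 0 \<or> digit j i = 1"
proof -
  let ?x = "j + int i * p"
  have "?x div q \<le> (?x + p) div q" "(?x + p) div q \<le> (?x + q) div q"
    using p_pos p_less q_pos zdiv_mono1[of ?x "?x + p" q] zdiv_mono1[of "?x + p" "?x + q" q] by auto
  moreover have "(?x + q) div q = ?x div q + 1"
    using q_pos by simp
  ultimately show ?thesis
    unfolding digit_def by (simp add: algebra_simps) linarith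
qed

lemma digit_periodic: "digit j (i + nat q) = digit j i"
proof -
  have "(j + int (k + nat q) * p) div q = (j + int k * p) div q + p" for k
  proof -
    have "j + int (k + nat q) * p = (j + int k * p) + p * q"
      using q_pos by (simp add: algebra_simps)
    then have "(j + int (k + nat q) * p) div q = ((j + int k * p) + p * q) div q"
      by (rule arg_cong)
    also have "\<dots> = (j + int k * p) div q + p"
      using q_pos div_mult_self1[of q "j + int k * p" p] by linarith
    finally show ?thesis .
  qed
  from this[of "Suc i"] this[of i] show ?thesis
    unfolding digit_def by simp
qed

lemma digit_mod: "digit j (i mod nat q) = digit j i"
proof -
  have "digit j (k + m * nat q) = digit j k" for k m
  proof (induction m)
    case (Suc m)
    then show ?case
      using digit_periodic[of j "k + m * nat q"] by (simp add: ac_simps)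
  qed simp
  from this[of "i mod nat q" "i div nat q"] show ?thesis
    by simp
qed

text \<open>Subtracting the series of \<open>h j\<close> from that of \<open>h (j + p)\<close>
  leaves the digits, and \<open>h_shift\<close> evaluates the difference. For
  \<open>0 \<le> j < q\<close> this is a binary expansion of \<open>h j\<close> itself.\<close>

lemma digit_sums: "(\<lambda>n. real_of_int (digit j n) / 2 ^ Suc n) sums (h j - real_of_int (j div q))"
proof -
  have "(\<lambda>n. real_of_int ((j + p + int n * p) div q) / 2 ^ Suc n
      - real_of_int ((j + int n * p) div q) / 2 ^ Suc n) sums (h (j + p) - h j)"
    unfolding h_def by (intro sums_diff summable_sums summable_h)
  moreover have "real_of_int ((j + p + int n * p) div q) / 2 ^ Suc n
      - real_of_int ((j + int n * p) div q) / 2 ^ Suc n = real_of_int (digit j n) / 2 ^ Suc n" for n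
    by (simp add: digit_def algebra_simps diff_divide_distrib)
  ultimately show ?thesis
    by (simp add: h_shift)
qed

lemma h_le_1:
  assumes "0 \<le> j" "j < q"
  shows "h j \<le> 1"
proof -
  have "real_of_int (digit j n) / 2 ^ Suc n \<le> (1/2) ^ Suc n" for n
    using digit_cases[of j n] by (auto simp: power_one_over)
  with digit_sums[of j] power_half_series show ?thesis
    using assms by (intro sums_le[of _ _ "h j" 1]) auto
qed

text \<open>No floor is negative, and the one at \<open>n = q\<close> equals
  \<open>p\<close>.\<close>

lemma h_0_pos: "0 < h 0"
proof -
  define f where "f n = real_of_int ((0 + int n * p) div q) / 2 ^ Suc n" for n
  have "0 \<le> (0 + int n * p) div q" for n
  proof -
    have "0 \<le> 0 + int n * p"
      using p_pos by (intro add_nonneg_nonneg mult_nonneg_nonneg) simp_all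
    then show ?thesis
      by (rule iffD2[OF pos_imp_zdiv_nonneg_iff[OF q_pos]])
  qed
  then have "0 \<le> f n" for n
    unfolding f_def by (intro divide_nonneg_pos) simp_all
  moreover have "(0 + int (nat q) * p) div q = p"
    using q_pos by simp
  then have "f (nat q) = real_of_int p / 2 ^ Suc (nat q)"
    unfolding f_def by (rule arg_cong)
  then have "0 < f (nat q)"
    using p_pos by (simp del: power_Suc)
  moreover have "summable f"
    unfolding f_def by (rule summable_h)
  ultimately have "0 < suminf f"
    by (metis suminf_pos2)
  then show ?thesis
    unfolding h_def f_def .
qed

text \<open>Comparison with the expansion 0.111...: the digit of index 0 is 0, so the sum falls
  short of 1.\<close>

lemma h_0_less_1: "h 0 < 1"
proof -
  define f where "f n = (1/2) ^ Suc n - real_of_int (digit 0 n) / 2 ^ Suc n" for n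
  have "f sums (1 - (h 0 - real_of_int (0 div q)))"
    unfolding f_def by (rule sums_diff[OF power_half_series digit_sums])
  then have s: "f sums (1 - h 0)"
    by simp
  have "0 \<le> f n" for n
    using digit_cases[of 0 n] by (auto simp: power_one_over f_def)
  moreover have "digit 0 0 = 0"
    using p_pos p_less by (simp add: digit_def)
  then have "0 < f 0"
    by (simp add: f_def)
  ultimately have "0 < suminf f"
    using s by (metis suminf_pos2 sums_summable)
  with s show ?thesis
    by (simp add: sums_iff)
qed

section \<open>Doubling on the periodic orbit\<close>

text \<open>Adding \<open>p\<close> to \<open>q - p\<close> completes one full turn, so the point
  \<open>h (q - p)\<close> just beyond 1/2 is doubled onto \<open>h 0\<close>.\<close>

lemma h_complement: "2 * h (q - p) = 1 + h 0"
  using h_shift[of "q - p"] h_add_period[of 0] p_pos p_less by simp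

lemma doubling_h:
  assumes "0 \<le> j" "j < q"
  shows "doubling (h j) = h ((j + p) mod q)"
proof (cases "j < q - p")
  case True
  then have "h (j + p) = 2 * h j" "h (j + p) \<le> 1"
    using assms p_pos h_shift[of j] h_le_1[of "j + p"] by auto
  with True assms p_pos show ?thesis by (simp add: doubling_def)
next
  case False
  then have "(j + p) mod q = j + p - q"
    using assms p_less minus_mod_self2[of "j + p" q] mod_pos_pos_trivial[of "j + p - q" q] by auto
  moreover have "h (j + p) = 2 * h j" "h (j + p) = h (j + p - q) + 1"
    using assms h_shift[of j] h_add_period[of "j + p - q"] by auto
  \<comment> \<open>Strictness puts \<open>h j\<close> beyond 1/2, which itself belongs to the left
    branch of \<open>doubling\<close>.\<close>
  moreover have "0 < h (j + p - q)"
    using False h_0_pos h_mono[of 0 "j + p - q"] by linarith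
  ultimately show ?thesis by (simp add: doubling_def)
qed

lemma doubling_orbit_h:
  assumes "0 \<le> j" "j < q"
  shows "(doubling ^^ k) (h j) = h ((j + int k * p) mod q)"
proof (induction k)
  case (Suc k)
  then show ?case
    using q_pos by (simp add: doubling_h mod_simps algebra_simps)
qed (use assms in simp)

text \<open>The lift \<open>Y k = y k + N k\<close> sits in a gap between consecutive points of the lifted periodic
  orbit \<open>h\<close>; its distance to the left end of the gap doubles at every step but stays
  bounded, so it is 0, and the orbit runs into the excluded point \<open>h 0\<close>.\<close>

lemma no_orbit_in_half_circle:
  fixes y :: "nat \<Rightarrow> real" and d :: "nat \<Rightarrow> int"
  assumes step: "\<And>k. y (Suc k) = 2 * y k - real_of_int (d k)"
    and lower: "\<And>k. h 0 < y k" and upper: "\<And>k. y k \<le> h 0 + 1/2"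
  shows False
proof -
  define N where "N k = (\<Sum>i<k. d i)" for k
  define Y where "Y k = y k + real_of_int (N k)" for k
  \<comment> \<open>\<open>N\<close> collects all earlier carries, so the new carry
    \<open>d k\<close> cancels.\<close>
  have Y_Suc: "Y (Suc k) = 2 * Y k - real_of_int (N k)" for k
    by (simp add: Y_def N_def step)
  \<comment> \<open>A discrete intermediate value argument: otherwise all of \<open>h 0\<close>,
    \<open>h 1\<close>, ... stay at or below \<open>y 0\<close>, although
    \<open>h q = h 0 + 1\<close> exceeds it.\<close>
  have "\<exists>i. h i \<le> y 0 \<and> y 0 \<le> h (i + 1)"
  proof (rule ccontr)
    assume contra: "\<not> ?thesis"
    have "h (int n) \<le> y 0" for n
    proof (induction n)
      case 0
      then show ?case using lower[of 0] by simp
    next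
      case (Suc n)
      with contra show ?case by (metis le_cases of_nat_Suc add.commute)
    qed
    from this[of "nat q"] h_add_period[of 0] upper[of 0] q_pos show False by simp
  qed
  then obtain i where i: "h i \<le> y 0" "y 0 \<le> h (i + 1)" by blast
  define j where "j k = i + int k * p" for k
  have j_Suc: "j (Suc k) = j k + p" for k
    by (simp add: j_def algebra_simps)
  \<comment> \<open>A gap between neighbours lies within one unit interval starting at
    \<open>h 0\<close> plus an integer. As \<open>y k\<close> lies in the lower half of such an
    interval, the integer parts must agree.\<close>
  have N_eq: "N k = j k div q" if "h (j k) \<le> Y k" "Y k \<le> h (j k + 1)" for k
  proof -
    let ?M = "j k div q"
    have jM: "j k = j k mod q + ?M * q" by simp
    have "h 0 + ?M \<le> h (j k)"
      using h_mono[of "?M * q" "j k"] h_add_periods[of 0 ?M] q_pos jM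
      by (simp add: minus_mod_eq_div_mult[symmetric])
    moreover have "h (j k + 1) \<le> h 0 + ?M + 1"
    proof -
      have "j k mod q < q" using q_pos by simp
      then have "j k + 1 \<le> (?M + 1) * q"
        using jM unfolding distrib_right by linarith
      then show ?thesis
        using h_mono[of "j k + 1" "(?M + 1) * q"] h_add_periods[of 0 "?M + 1"] by simp
    qed
    ultimately have "real_of_int (N k) < ?M + 1" "real_of_int ?M < N k + 1"
      using that lower[of k] upper[of k] by (auto simp: Y_def)
    then show ?thesis by linarith
  qed
  have between: "h (j k) \<le> Y k \<and> Y k \<le> h (j k + 1) \<and> Y k - h (j k) = 2 ^ k * (y 0 - h i)" for k
  proof (induction k)
    case 0
    then show ?case using i by (simp add: Y_def N_def j_def)
  next
    case (Suc k)
    let ?M = "j k div q"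
    have N: "N k = ?M" using Suc N_eq by blast
    have h_Suc: "h (j (Suc k)) = 2 * h (j k) - ?M"
      using h_shift[of "j k"] by (simp add: j_Suc)
    have "Y (Suc k) \<le> h (j (Suc k) + 1)"
    proof (cases "(j k + 1) div q = ?M")
      case True
      then have "h (j (Suc k) + 1) = 2 * h (j k + 1) - ?M"
        using h_shift[of "j k + 1"] by (simp add: j_Suc algebra_simps)
      then show ?thesis using Suc Y_Suc[of k] N by simp
    next
      case False
      \<comment> \<open>Here the right neighbour begins a new turn and has a carry one larger. Its
        image is \<open>2 * h 0 + ?M + 1\<close>, and \<open>y k \<le> h 0 + 1/2\<close> is exactly
        what keeps \<open>Y (Suc k)\<close> below it.\<close>
      have "j k + 1 = (?M + 1) * q"
      proof -
        have "j k mod q + 1 = q"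
        proof (rule ccontr)
          assume "j k mod q + 1 \<noteq> q"
          then have "j k mod q + 1 < q" "0 \<le> j k mod q"
            using pos_mod_bound[OF q_pos, of "j k"] pos_mod_sign[OF q_pos, of "j k"] by auto
          then have "(j k mod q + 1) div q = 0"
            by (intro div_pos_pos_trivial) auto
          then have "(j k mod q + 1 + ?M * q) div q = ?M"
            using div_mult_self1[of q "j k mod q + 1" ?M] q_pos by linarith
          moreover have "j k mod q + 1 + ?M * q = j k + 1"
            using div_mult_mod_eq[of "j k" q] by linarith
          ultimately show False using False by metis
        qed
        then show ?thesis
          using div_mult_mod_eq[of "j k" q] unfolding distrib_right by linarith
      qed
      then have "h (j k + 1) = h (0 + (?M + 1) * q)" "(j k + 1) div q = ?M + 1"
        using q_pos by auto
      moreover have "h (j (Suc k) + 1) = h (j k + 1 + p)"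
        by (simp add: j_Suc ac_simps)
      ultimately have "h (j k + 1) = h 0 + ?M + 1" "h (j (Suc k) + 1) = 2 * h (j k + 1) - (?M + 1)"
        using h_add_periods[of 0 "?M + 1"] h_shift[of "j k + 1"] by simp_all
      then show ?thesis
        using upper[of k] Y_Suc[of k] N by (simp add: Y_def)
    qed
    with Suc h_Suc N Y_Suc[of k] show ?case by auto
  qed
  have "y 0 = h i"
  proof (rule ccontr)
    assume "y 0 \<noteq> h i"
    with i have pos: "0 < y 0 - h i" by simp
    obtain k where "1 / (y 0 - h i) < 2 ^ k"
      using real_arch_pow[of 2] by auto
    then have "1 < 2 ^ k * (y 0 - h i)"
      using pos by (simp add: field_simps)
    moreover have "h (j k + 1) \<le> h (j k) + 1"
      using h_mono[of "j k + 1" "j k + q"] h_add_period[of "j k"] q_pos by simp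
    ultimately show False using between[of k] by simp
  qed
  then have Y_eq: "Y k = h (j k)" for k
    using between[of k] by simp
  obtain k where "q dvd j k"
  proof -
    obtain u v where uv: "u * p + v * q = 1"
      using bezout_int[of p q] coprime_pq by (auto simp: coprime_iff_gcd_eq_1)
    \<comment> \<open>By Bezout \<open>u\<close> inverts \<open>p\<close> modulo \<open>q\<close>,
      so \<open>- i * u\<close> steps lead from \<open>i\<close> to a multiple of \<open>q\<close>.
      Reduction modulo \<open>q\<close> makes the number of steps non-negative.\<close>
    define k where "k = (- i * u) mod q"
    define D where "D = (- i * u) div q"
    have "k = - i * u - q * D"
      unfolding k_def D_def by (rule minus_mult_div_eq_mod[symmetric])
    with uv have "i + k * p = q * (i * v - D * p)"
      by algebra
    then have "q dvd i + k * p" by simp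
    moreover have "0 \<le> k"
      unfolding k_def using q_pos by simp
    ultimately show ?thesis
      using that[of "nat k"] by (simp add: j_def)
  qed
  then have "Y k = h 0 + real_of_int (j k div q)"
    using Y_eq[of k] h_add_periods[of 0 "j k div q"] by simp
  moreover have "N k = j k div q"
    using N_eq between by blast
  ultimately show False
    using lower[of k] by (simp add: Y_def)
qed

end

section \<open>Prefix sums and cyclic windows of words\<close>

lemma count_list_binary: "set w \<subseteq> {0, 1} \<Longrightarrow> count_list w 1 = sum_list w" for w :: "nat list"
  by (induction w) auto

lemma sublistE_take_drop:
  assumes "sublist u xs"
  obtains m where "m + length u \<le> length xs" "u = take (length u) (drop m xs)"
proof -
  from assms obtain ps ss where "xs = ps @ u @ ss"
    by (auto simp: sublist_def)
  then show ?thesis by (intro that[of "length ps"]) auto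
qed

lemma sublist_take_drop: "sublist (take n (drop m xs)) xs"
  unfolding sublist_def
  by (intro exI[of _ "take m xs"] exI[of _ "drop n (drop m xs)"]) (simp only: append_take_drop_id)

text \<open>At the first position where the words differ, their prefix sums differ in the same
  direction.\<close>

lemma list_le_if_prefix_sums_le:
  fixes u v :: "nat list"
  assumes "length u = length v"
    and "\<And>n. n \<le> length u \<Longrightarrow> sum_list (take n u) \<le> sum_list (take n v)"
  shows "u \<le> v"
  using assms
proof (induction u v rule: list_induct2)
  case (Cons x xs y ys)
  show ?case
  proof (cases "x = y")
    case True
    have "sum_list (take n xs) \<le> sum_list (take n ys)" if "n \<le> length xs" for n
      using Cons.prems[of "Suc n"] that True by simp
    with Cons.IH True show ?thesis by simp
  next
    case False
    with Cons.prems[of 1] show ?thesis by simp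
  qed
qed simp

lemma cycle_snth:
  assumes "u \<noteq> []"
  shows "cycle u !! n = u ! (n mod length u)"
proof -
  have "shd (sdrop n (cycle u)) = hd (rotate (n mod length u) u)"
    unfolding sdrop_cycle[OF assms] by (rule cycle.sel)
  then show ?thesis
    using assms by (simp add: hd_rotate_conv_nth)
qed

lemma sum_list_take_drop:
  fixes xs :: "nat list"
  assumes "i + n \<le> length xs"
  shows "sum_list (take n (drop i xs)) = (\<Sum>m<n. xs ! (i + m))"
proof -
  have "min (length xs - i) n = n"
    using assms by simp
  with assms show ?thesis
    by (simp add: sum_list_sum_nth atLeast0LessThan min.commute)
qed

text \<open>Double counting: each letter lies in exactly \<open>n\<close> of the cyclic windows of
  length \<open>n\<close>.\<close>

lemma sum_windows:
  fixes w :: "nat list"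
  assumes "n \<le> length w"
  shows "(\<Sum>i<length w. sum_list (take n (drop i (w @ w)))) = n * sum_list w"
proof -
  let ?Q = "length w"
  define f where "f i = w ! (i mod ?Q)" for i
  have shift: "(\<Sum>i<?Q. f (i + m)) = (\<Sum>i<?Q. f i)" for m
  proof (induction m)
    case (Suc m)
    have "(\<Sum>i<Suc ?Q. f (i + m)) = f m + (\<Sum>i<?Q. f (i + Suc m))"
      by (subst sum.lessThan_Suc_shift) simp
    moreover have "f (?Q + m) = f m"
      by (simp add: f_def)
    ultimately show ?case using Suc by simp
  qed simp
  have "(\<Sum>i<?Q. sum_list (take n (drop i (w @ w)))) = (\<Sum>i<?Q. \<Sum>m<n. f (i + m))"
  proof (rule sum.cong)
    fix i assume i: "i \<in> {..<?Q}"
    have "(w @ w) ! (i + m) = f (i + m)" if "m < n" for m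
      using i that assms by (cases "i + m < ?Q") (auto simp: f_def nth_append le_mod_geq)
    with i assms show "sum_list (take n (drop i (w @ w))) = (\<Sum>m<n. f (i + m))"
      by (subst sum_list_take_drop) auto
  qed simp
  also have "\<dots> = (\<Sum>m<n. \<Sum>i<?Q. f (i + m))"
    by (rule sum.swap)
  also have "\<dots> = n * (\<Sum>i<?Q. f i)"
    by (simp add: shift)
  also have "(\<Sum>i<?Q. f i) = sum_list w"
    by (simp add: f_def sum_list_sum_nth atLeast0LessThan)
  finally show ?thesis .
qed

text \<open>Each cyclic window count differs by at most 1 from every other one, hence by less than 1
  from their average.\<close>

lemma cyclically_balanced_window:
  fixes w :: "nat list"
  assumes "cyclically_balanced w" "set w \<subseteq> {0, 1}" "i < length w" "n \<le> length w"
  defines "c \<equiv> sum_list (take n (drop i (w @ w)))"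
  shows "length w * c < n * sum_list w + length w"
    and "n * sum_list w < length w * c + length w"
proof -
  let ?Q = "length w"
  define s where "s k = sum_list (take n (drop k (w @ w)))" for k
  have close: "s k \<le> s l + 1" if "k < ?Q" "l < ?Q" for k l
  proof -
    have "set (take n (drop m (w @ w))) \<subseteq> {0, 1}" for m
    proof -
      have "set (take n (drop m (w @ w))) \<subseteq> set (w @ w)"
        by (rule set_mono_sublist[OF sublist_take_drop])
      also have "set (w @ w) = set w"
        unfolding set_append by (rule Un_absorb)
      also note assms(2)
      finally show ?thesis .
    qed
    then have count: "count_list (take n (drop m (w @ w))) 1 = s m" for m
      unfolding s_def by (rule count_list_binary)
    have "length (take n (drop k (w @ w))) = length (take n (drop l (w @ w)))"
      using that assms(4) by simp
    moreover have "sublist (take n (drop m (w @ w))) (w @ w)" for m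
      by (rule sublist_take_drop)
    ultimately have "\<bar>int (count_list (take n (drop k (w @ w))) 1)
        - int (count_list (take n (drop l (w @ w))) 1)\<bar> \<le> 1"
      using assms(1) unfolding cyclically_balanced_def balanced_def by blast
    then have "\<bar>int (s k) - int (s l)\<bar> \<le> 1"
      by (simp only: count)
    then show ?thesis by linarith
  qed
  have total: "(\<Sum>k<?Q. s k) = n * sum_list w"
    unfolding s_def by (rule sum_windows[OF assms(4)])
  have c: "c = s i"
    by (simp add: c_def s_def)
  \<comment> \<open>Strictness, here and in the mirrored estimate, comes from the term
    \<open>k = i\<close>.\<close>
  have "(\<Sum>k<?Q. s i) < (\<Sum>k<?Q. s k + 1)"
    using close assms(3) by (intro sum_strict_mono_ex1) auto
  then show "?Q * c < n * sum_list w + ?Q"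
    using total by (simp only: c sum.distrib) simp
  have "(\<Sum>k<?Q. s k) < (\<Sum>k<?Q. s i + 1)"
    using close assms(3) by (intro sum_strict_mono_ex1) auto
  then show "n * sum_list w < ?Q * c + ?Q"
    using total by (simp add: c)
qed

section \<open>Identification of the extremal balanced words\<close>

context rotation
begin

text \<open>One period of the digit sequence. As \<open>j\<close> varies, these are the conjugates
  of a single word of slope p/q.\<close>

definition word :: "int \<Rightarrow> nat list" where
  "word j = map (\<lambda>i. nat (digit j i)) [0..<nat q]"

lemma length_word: "length (word j) = nat q"
  by (simp add: word_def)

lemma word_neq_Nil: "word j \<noteq> []"
  using q_pos by (simp add: word_def)

lemma set_word: "set (word j) \<subseteq> {0, 1}"
proof -
  have "nat (digit j i) \<in> {0, 1}" for i
    using digit_cases[of j i] by auto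
  then show ?thesis
    unfolding word_def by (simp only: set_map image_subset_iff) blast
qed

lemma hd_word: "hd (word j) = nat (digit j 0)"
  using q_pos by (simp add: word_def hd_map)

lemma word_append_word: "word j @ word j = map (\<lambda>i. nat (digit j i)) [0..<nat q + nat q]"
proof -
  have "[nat q..<nat q + nat q] = map (\<lambda>i. i + nat q) [0..<nat q]"
    by (simp add: map_add_upt)
  then have "map (\<lambda>i. nat (digit j i)) [nat q..<nat q + nat q] = word j"
    by (simp add: word_def digit_periodic)
  then show ?thesis
    by (simp only: upt_add_eq_append[OF le0, of "nat q" "nat q"] map_append) (simp only: word_def)
qed

text \<open>The digits telescope.\<close>

lemma sum_list_digits:
  "int (sum_list (map (\<lambda>i. nat (digit j i)) [m..<m + n]))
    = (j + int (m + n) * p) div q - (j + int m * p) div q"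
proof (induction n)
  case (Suc n)
  have "int (nat (digit j (m + n))) = digit j (m + n)"
    using digit_cases[of j "m + n"] by auto
  with Suc show ?case
    by (simp add: digit_def)
qed simp

lemma sum_list_take_word:
  assumes "n \<le> nat q"
  shows "int (sum_list (take n (word j))) = (j + int n * p) div q - j div q"
  using sum_list_digits[of j 0 n] assms by (simp add: word_def take_map)

text \<open>The source of balance: the increment of the floor over a step \<open>b\<close> takes
  only two neighbouring values, whatever the starting point \<open>x\<close>.\<close>

lemma div_add_cases: "(x + b) div q = x div q + b div q \<or> (x + b) div q = x div q + b div q + 1"
proof -
  let ?s = "x mod q + b mod q"
  have s: "0 \<le> ?s" "?s < 2 * q"
    using pos_mod_bound[OF q_pos, of x] pos_mod_bound[OF q_pos, of b]
      pos_mod_sign[OF q_pos, of x] pos_mod_sign[OF q_pos, of b] by linarith+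
  have "?s div q = 0 \<or> ?s div q = 1"
  proof (cases "?s < q")
    case True
    with s show ?thesis by (simp add: div_pos_pos_trivial)
  next
    case False
    then have "(?s - q) div q = 0"
      using s by (intro div_pos_pos_trivial) auto
    then show ?thesis
      using div_add_self2[of q "?s - q"] q_pos by simp
  qed
  then show ?thesis
    using div_add1_eq[of x b q] by linarith
qed

lemma cyclically_balanced_word: "cyclically_balanced (word j)"
  unfolding cyclically_balanced_def balanced_def
proof (intro allI impI, elim conjE)
  fix u v
  assume uv: "sublist u (word j @ word j)" "sublist v (word j @ word j)" "length u = length v"
  have count: "\<exists>x. int (count_list u 1) = (x + int (length u) * p) div q - x div q"
    if "sublist u (word j @ word j)" for u
  proof -
    from that obtain m where m: "m + length u \<le> length (word j @ word j)"
      "u = take (length u) (drop m (word j @ word j))"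
      by (rule sublistE_take_drop)
    then have u: "u = map (\<lambda>i. nat (digit j i)) [m..<m + length u]"
      unfolding word_append_word by (simp add: take_map drop_map)
    have "set u \<subseteq> {0, 1}"
      using set_mono_sublist[OF that] set_word[of j] by auto
    then have "count_list u 1 = sum_list u"
      by (rule count_list_binary)
    also have "sum_list u = sum_list (map (\<lambda>i. nat (digit j i)) [m..<m + length u])"
      using u by (rule arg_cong)
    finally have "int (count_list u 1) = (j + int (m + length u) * p) div q - (j + int m * p) div q"
      by (simp only: sum_list_digits)
    then show ?thesis
      by (intro exI[of _ "j + int m * p"]) (simp add: algebra_simps)
  qed
  from count[OF uv(1)] count[OF uv(2)] uv(3) obtain x y where
    "int (count_list u 1) = (x + int (length v) * p) div q - x div q"
    "int (count_list v 1) = (y + int (length v) * p) div q - y div q"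
    by metis
  then show "\<bar>int (count_list u 1) - int (count_list v 1)\<bar> \<le> 1"
    using div_add_cases[of x "int (length v) * p"] div_add_cases[of y "int (length v) * p"]
    by linarith
qed

lemma sum_list_word: "sum_list (word j) = nat p"
proof -
  have "(j + q * p) div q = j div q + p"
    using div_mult_self2[of q j p] q_pos by simp
  then show ?thesis
    using sum_list_take_word[of "nat q" j] q_pos by (simp add: length_word)
qed

lemma cb_words_eq:
  assumes "quotient_of r = (p, q)"
  shows "cb_words r = {w. set w \<subseteq> {0, 1} \<and> cyclically_balanced w \<and> length w = nat q \<and> sum_list w = nat p}"
proof -
  have len: "int (length w) = q \<longleftrightarrow> length w = nat q" for w :: "nat list"
    using q_pos by auto
  have cnt: "int (count_list w 1) = p \<longleftrightarrow> sum_list w = nat p" if "set w \<subseteq> {0, 1}" for w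
    using count_list_binary[OF that] p_pos by auto
  show ?thesis
    unfolding cb_words_def assms fst_conv snd_conv
    by (intro Collect_cong conj_cong refl len cnt)
qed

lemma word_in_cb_words:
  assumes "quotient_of r = (p, q)"
  shows "word j \<in> cb_words r"
  unfolding cb_words_eq[OF assms]
  using set_word cyclically_balanced_word by (auto simp: length_word sum_list_word)

lemma finite_cb_words: "finite (cb_words r)"
  by (rule finite_subset[OF _ finite_lists_length_eq[of "{0, 1}" "nat (snd (quotient_of r))"]])
    (auto simp: cb_words_def)

text \<open>The window of length \<open>n\<close> after the first letter contains
  \<open>n * p / q\<close> ones up to an error below 1; integrality turns this into a floor and a
  ceiling. The first letter is split off because the extremal words are chosen with it
  prescribed.\<close>

lemma cb_word_prefix_bounds:
  assumes "quotient_of r = (p, q)" "w \<in> cb_words r" "Suc n \<le> nat q"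
  shows "int (sum_list (take (Suc n) w)) \<le> int (hd w) + (int n * p + q - 1) div q"
    and "int (hd w) + int n * p div q \<le> int (sum_list (take (Suc n) w))"
proof -
  from assms(1,2) have w: "set w \<subseteq> {0, 1}" "cyclically_balanced w" "length w = nat q" "sum_list w = nat p"
    by (auto simp: cb_words_eq)
  then obtain x v where xv: "w = x # v"
    using q_pos by (cases w) auto
  have len: "1 < length w"
    using w p_pos p_less by simp
  have "take n (drop 1 (w @ w)) = take n v"
    using w assms(3) xv by simp
  then have c: "length w * sum_list (take n v) < n * sum_list w + length w"
      "n * sum_list w < length w * sum_list (take n v) + length w"
    using cyclically_balanced_window[OF w(2,1) len, of n] w(3) assms(3) by auto
  let ?c = "int (sum_list (take n v))"
  have "q * ?c < int n * p + q" "int n * p < q * ?c + q"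
    using c[folded of_nat_less_iff[where 'a = int]] w(3,4) p_pos q_pos by auto
  then have "?c * q \<le> int n * p + q - 1" "int n * p \<le> (q - 1) + ?c * q"
    by (simp_all add: mult.commute)
  then have "?c * q div q \<le> (int n * p + q - 1) div q" "int n * p div q \<le> ((q - 1) + ?c * q) div q"
    using q_pos by (intro zdiv_mono1; simp)+
  moreover have "((q - 1) + ?c * q) div q = ?c"
    using div_mult_self1[of q "q - 1" ?c] div_pos_pos_trivial[of "q - 1" q] q_pos by linarith
  ultimately have "?c \<le> (int n * p + q - 1) div q" "int n * p div q \<le> ?c"
    using q_pos by auto
  then show "int (sum_list (take (Suc n) w)) \<le> int (hd w) + (int n * p + q - 1) div q"
    "int (hd w) + int n * p div q \<le> int (sum_list (take (Suc n) w))"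
    by (auto simp: xv)
qed

lemma digit_0_upper: "digit (q - p) 0 = 1"
  using p_pos p_less by (simp add: digit_def)

lemma digit_0_lower: "digit (q - p - 1) 0 = 0"
  using p_pos p_less by (simp add: digit_def)

text \<open>For \<open>0 \<le> j < q\<close> the first digit is 1 exactly from
  \<open>j = q - p\<close> on, so \<open>q - p - 1\<close> is the last index with first digit 0. Its
  word attains the upper prefix bound at all lengths at once and is therefore maximal.\<close>

lemma omega_minus_eq:
  assumes "quotient_of r = (p, q)"
  shows "omega_minus r = word (q - p - 1)"
  unfolding omega_minus_def
proof (rule Max_eqI)
  show "finite {w \<in> cb_words r. hd w = 0}"
    using finite_cb_words by simp
  show "word (q - p - 1) \<in> {w \<in> cb_words r. hd w = 0}"
    using word_in_cb_words[OF assms] by (simp add: hd_word digit_0_lower)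
  fix w assume w: "w \<in> {w \<in> cb_words r. hd w = 0}"
  then have len: "length w = nat q"
    using cb_words_eq[OF assms] by auto
  show "w \<le> word (q - p - 1)"
  proof (rule list_le_if_prefix_sums_le)
    fix n assume n: "n \<le> length w"
    show "sum_list (take n w) \<le> sum_list (take n (word (q - p - 1)))"
    proof (cases n)
      case (Suc k)
      have "int (sum_list (take n (word (q - p - 1)))) = (int k * p + q - 1) div q"
        using sum_list_take_word[of n "q - p - 1"] n len Suc p_pos p_less
        by (simp add: algebra_simps)
      moreover have "int (sum_list (take n w)) \<le> (int k * p + q - 1) div q"
        using cb_word_prefix_bounds(1)[OF assms, of w k] n len Suc w by simp
      ultimately show ?thesis by linarith
    qed simp
  qed (simp add: len length_word)
qed

text \<open>Dually, the first index with first digit 1 attains the lower prefix bound at all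
  lengths.\<close>

lemma omega_plus_eq:
  assumes "quotient_of r = (p, q)"
  shows "omega_plus r = word (q - p)"
  unfolding omega_plus_def
proof (rule Min_eqI)
  show "finite {w \<in> cb_words r. hd w = 1}"
    using finite_cb_words by simp
  show "word (q - p) \<in> {w \<in> cb_words r. hd w = 1}"
    using word_in_cb_words[OF assms] by (simp add: hd_word digit_0_upper)
  fix w assume w: "w \<in> {w \<in> cb_words r. hd w = 1}"
  then have len: "length w = nat q"
    using cb_words_eq[OF assms] by auto
  show "word (q - p) \<le> w"
  proof (rule list_le_if_prefix_sums_le)
    fix n assume n: "n \<le> length (word (q - p))"
    show "sum_list (take n (word (q - p))) \<le> sum_list (take n w)"
    proof (cases n)
      case (Suc k)
      have "q - p + int n * p = int k * p + q"
        using Suc by (simp add: algebra_simps)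
      then have "(q - p + int n * p) div q = (int k * p + q) div q"
        by (rule arg_cong)
      also have "\<dots> = int k * p div q + 1"
        using q_pos by (intro div_add_self2) simp
      finally have "(q - p + int n * p) div q = int k * p div q + 1" .
      then have "int (sum_list (take n (word (q - p)))) = 1 + int k * p div q"
        using sum_list_take_word[of n "q - p"] n Suc p_pos p_less
        by (simp add: length_word)
      moreover have "1 + int k * p div q \<le> int (sum_list (take n w))"
        using cb_word_prefix_bounds(2)[OF assms, of w k] n Suc w by (simp add: length_word)
      ultimately show ?thesis by linarith
    qed simp
  qed (simp add: len length_word)
qed

section \<open>Real values of the periodic words\<close>

lemma cycle_word_snth: "real (cycle (word j) !! n) = real_of_int (digit j n)"
proof -
  have "n mod nat q < nat q"
    using q_pos by simp
  then have "cycle (word j) !! n = nat (digit j n)"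
    by (simp add: cycle_snth[OF word_neq_Nil] length_word) (simp add: word_def digit_mod)
  then show ?thesis
    using digit_cases[of j n] by auto
qed

lemma word_val_cycle_word: "word_val (cycle (word j)) = h j - real_of_int (j div q)"
  unfolding word_val_def using digit_sums[of j] by (simp only: cycle_word_snth sums_iff)

lemma word_val_cycle_upper: "word_val (cycle (word (q - p))) = h (q - p)"
  using p_pos p_less by (simp add: word_val_cycle_word)

lemma word_val_cycle_lower: "word_val (cycle (word (q - p - 1))) = h (q - p - 1)"
  using p_pos p_less by (simp add: word_val_cycle_word)

lemma div_minus_1:
  assumes "\<not> q dvd x"
  shows "(x - 1) div q = x div q"
proof -
  have "x mod q \<noteq> 0" using assms by (simp add: dvd_eq_mod_eq_0)
  then have "0 \<le> x mod q - 1" "x mod q - 1 < q"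
    using pos_mod_bound[OF q_pos, of x] pos_mod_sign[OF q_pos, of x] by auto
  then have "(x mod q - 1) div q = 0"
    by (intro div_pos_pos_trivial) auto
  then have "(x mod q - 1 + x div q * q) div q = x div q"
    using div_mult_self1[of q "x mod q - 1" "x div q"] q_pos by linarith
  moreover have "x mod q - 1 + x div q * q = x - 1"
    using div_mult_mod_eq[of x q] by linarith
  ultimately show ?thesis by metis
qed

text \<open>The floors could differ only if \<open>q\<close> divided \<open>q + (m - 1) * p\<close>,
  hence \<open>m - 1\<close> by coprimality; but \<open>m - 1\<close> lies strictly between 0 and
  \<open>q\<close>.\<close>

lemma floor_lower_eq_upper:
  assumes "2 \<le> m" "m \<le> nat q"
  shows "(q - p - 1 + int m * p) div q = (q - p + int m * p) div q"
proof -
  have eq: "q - p + int m * p = q + int (m - 1) * p"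
    using assms by (simp add: algebra_simps of_nat_diff)
  have "\<not> q dvd int (m - 1)"
    using assms zdvd_imp_le[of q "int (m - 1)"] by auto
  then have "\<not> q dvd q - p + int m * p"
    using coprime_pq by (simp add: eq coprime_dvd_mult_left_iff coprime_commute)
  then show ?thesis
    using div_minus_1[of "q - p + int m * p"] by (simp add: algebra_simps)
qed

text \<open>The words \<open>word (q - p)\<close> and \<open>word (q - p - 1)\<close> have the form \<open>10u\<close> and \<open>01u\<close>.\<close>

lemma digit_lower_eq_upper:
  assumes "2 \<le> n" "n < nat q"
  shows "digit (q - p - 1) n = digit (q - p) n"
  using floor_lower_eq_upper[of n] floor_lower_eq_upper[of "Suc n"] assms by (simp add: digit_def)

lemma digit_1_upper: "digit (q - p) 1 = 0"
  using p_pos p_less by (simp add: digit_def algebra_simps)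

lemma digit_1_lower: "digit (q - p - 1) 1 = 1"
  using p_pos p_less floor_lower_eq_upper[of 2] by (simp add: digit_def algebra_simps)

text \<open>Replacing the leading 10 of the periodic expansion by 01 and keeping all later digits
  costs 1/2 - 1/4.\<close>

lemma word_val_preperiodic:
  "word_val (word (q - p - 1) @- cycle (word (q - p))) = h (q - p) - 1/4"
proof -
  define t where "t = word (q - p - 1) @- cycle (word (q - p))"
  define f where "f n = real_of_int (digit (q - p) n) / 2 ^ Suc n - real (t !! n) / 2 ^ Suc n" for n
  have t_low: "real (t !! n) = real_of_int (digit (q - p - 1) n)" if "n < nat q" for n
    using that digit_cases[of "q - p - 1" n]
    by (auto simp: t_def shift_snth_less length_word word_def)
  have t_high: "real (t !! n) = real_of_int (digit (q - p) n)" if "nat q \<le> n" for n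
    using that digit_periodic[of "q - p" "n - nat q"]
    by (simp add: t_def shift_snth_ge length_word cycle_word_snth)
  have "f n = 0" if "n \<notin> {0, 1}" for n
    using that t_low[of n] t_high[of n] digit_lower_eq_upper[of n]
    by (cases "n < nat q") (auto simp: f_def)
  then have "f sums (\<Sum>n\<in>{0, 1}. f n)"
    by (intro sums_finite) auto
  moreover have "f 0 = 1/2" "f 1 = - 1/4"
    using t_low[of 0] t_low[of 1] p_pos p_less digit_0_upper digit_1_upper digit_0_lower digit_1_lower
    by (auto simp: f_def)
  ultimately have "f sums (1/4)" by simp
  from sums_diff[OF digit_sums[of "q - p"] this]
  have "(\<lambda>n. real (t !! n) / 2 ^ Suc n) sums (h (q - p) - real_of_int ((q - p) div q) - 1/4)"
    by (simp add: f_def)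
  then have "word_val t = h (q - p) - real_of_int ((q - p) div q) - 1/4"
    unfolding word_val_def by (rule sums_unique[symmetric])
  moreover have "(q - p) div q = 0"
    using p_pos p_less by simp
  ultimately show ?thesis
    by (simp add: t_def)
qed

end

section \<open>Surviving orbits of the doubling map\<close>

lemma doubling_0: "doubling 0 = 0" and doubling_1: "doubling 1 = 1"
  by (auto simp: doubling_def)

lemma survivorI:
  assumes "0 \<le> x" "x \<le> 1" "\<And>n. (doubling ^^ n) x \<le> a \<or> b \<le> (doubling ^^ n) x"
  shows "x \<in> survivor a b"
proof -
  have "(doubling ^^ n) x \<notin> {a<..<b}" for n
    using assms(3)[of n] by auto
  with assms(1,2) show ?thesis
    by (simp add: survivor_def)
qed

lemma survivorD: "x \<in> survivor a b \<Longrightarrow> (doubling ^^ n) x \<le> a \<or> b \<le> (doubling ^^ n) x"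
  by (metis (mono_tags, lifting) greaterThanLessThan_iff mem_Collect_eq not_less survivor_def)

lemma zero_in_survivor: "0 \<le> a \<Longrightarrow> 0 \<in> survivor a b"
proof -
  have "(doubling ^^ n) 0 = 0" for n
    by (induction n) (auto simp: doubling_0)
  then show "0 \<le> a \<Longrightarrow> 0 \<in> survivor a b"
    by (simp add: survivor_def)
qed

lemma one_in_survivor: "b \<le> 1 \<Longrightarrow> 1 \<in> survivor a b"
proof -
  have "(doubling ^^ n) 1 = 1" for n
    by (induction n) (auto simp: doubling_1)
  then show "b \<le> 1 \<Longrightarrow> 1 \<in> survivor a b"
    by (simp add: survivor_def)
qed

lemma survivor_nontrivial_iff:
  assumes "0 \<le> a" "b \<le> 1"
  shows "survivor a b \<noteq> {0, 1} \<longleftrightarrow> (\<exists>x\<in>survivor a b. 0 < x \<and> x < 1)"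
proof
  assume "survivor a b \<noteq> {0, 1}"
  with zero_in_survivor[OF assms(1)] one_in_survivor[OF assms(2)]
  obtain x where x: "x \<in> survivor a b" "x \<noteq> 0" "x \<noteq> 1" by blast
  then have "0 \<le> x" "x \<le> 1" by (auto simp: survivor_def)
  with x(2,3) have "0 < x \<and> x < 1" by linarith
  with x(1) show "\<exists>x\<in>survivor a b. 0 < x \<and> x < 1" by blast
next
  assume "\<exists>x\<in>survivor a b. 0 < x \<and> x < 1"
  then obtain x where "x \<in> survivor a b" "x \<notin> {0, 1}" by auto
  then show "survivor a b \<noteq> {0, 1}" by blast
qed

lemma survivor_antimono: "b \<le> b' \<Longrightarrow> survivor a b' \<subseteq> survivor a b"
  by (auto simp: survivor_def)

lemma survivor_nontrivial_antimono:
  assumes "0 \<le> a" "b \<le> b'" "b' \<le> 1" "survivor a b' \<noteq> {0, 1}"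
  shows "survivor a b \<noteq> {0, 1}"
  using assms survivor_nontrivial_iff[of a b] survivor_nontrivial_iff[of a b']
    survivor_antimono[OF assms(2), of a] by auto

text \<open>A surviving orbit never visits \<open>1/2\<close>, so it stays inside \<open>(0, 1)\<close>; doubling pushes it away
  from 0 and from 1 until it enters \<open>[2b - 1, 2a]\<close>, which it cannot leave.\<close>

lemma survivor_enters_core:
  assumes ab: "0 < a" "a < 1/2" "1/2 < b" "b < 1"
    and x: "x \<in> survivor a b" "0 < x" "x < 1"
  obtains y where "y \<in> survivor a b" "\<And>n. (doubling ^^ n) y \<in> {2 * b - 1..2 * a}"
proof -
  define z where "z n = (doubling ^^ n) x" for n
  have z_Suc: "z (Suc n) = doubling (z n)" for n
    by (simp add: z_def)
  have gap: "z n \<le> a \<or> b \<le> z n" for n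
    unfolding z_def by (rule survivorD[OF x(1)])
  have z_low: "z (Suc n) = 2 * z n" if "z n \<le> a" for n
    using that ab by (simp add: z_Suc doubling_def)
  have z_high: "z (Suc n) = 2 * z n - 1" if "b \<le> z n" for n
    using that ab by (simp add: z_Suc doubling_def)
  have z01: "0 < z n \<and> z n < 1" for n
  proof (induction n)
    case (Suc n)
    then show ?case
      using gap[of n] z_low[of n] z_high[of n] ab by auto
  qed (use x in \<open>simp add: z_def\<close>)
  \<comment> \<open>A point left of the hole is positive and moves up under doubling; one right of
    it lands at or above \<open>2 * b - 1\<close>. The bound \<open>2 * a\<close> is
    mirrored.\<close>
  have low_stays: "2 * b - 1 \<le> z (Suc n)" if "2 * b - 1 \<le> z n" for n
    using that gap[of n] z_low[of n] z_high[of n] z01[of n] by auto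
  have high_stays: "z (Suc n) \<le> 2 * a" if "z n \<le> 2 * a" for n
    using that gap[of n] z_low[of n] z_high[of n] z01[of n] by auto
  have "\<exists>k. 2 * b - 1 \<le> z k"
  proof (rule ccontr)
    assume "\<not> ?thesis"
    then have less: "z k < 2 * b - 1" for k
      by (simp add: not_le)
    have "z k = 2 ^ k * x" for k
    proof (induction k)
      case (Suc k)
      have "z k \<le> a"
        using less[of k] gap[of k] ab by linarith
      with Suc show ?case by (simp add: z_low)
    qed (simp add: z_def)
    moreover obtain k where "1 / x < 2 ^ k"
      using real_arch_pow[of 2 "1 / x"] by auto
    ultimately have "1 < z k"
      using x(2) by (simp add: field_simps)
    with z01[of k] show False by simp
  qed
  then obtain k where k: "2 * b - 1 \<le> z k" by blast
  have "\<exists>l. z l \<le> 2 * a"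
  proof (rule ccontr)
    assume "\<not> ?thesis"
    then have less: "2 * a < z k" for k
      by (simp add: not_le)
    have "1 - z k = 2 ^ k * (1 - x)" for k
    proof (induction k)
      case (Suc k)
      have "b \<le> z k"
        using less[of k] gap[of k] ab by linarith
      with Suc show ?case by (simp add: z_high)
    qed (simp add: z_def)
    moreover obtain k where "1 / (1 - x) < 2 ^ k"
      using real_arch_pow[of 2 "1 / (1 - x)"] by auto
    ultimately have "1 < 1 - z k"
      using x(3) by (simp add: field_simps)
    with z01[of k] show False by simp
  qed
  then obtain l where l: "z l \<le> 2 * a" by blast
  have low: "2 * b - 1 \<le> z (k + n)" for n
    by (induction n) (auto simp: k low_stays)
  have high: "z (l + n) \<le> 2 * a" for n
    by (induction n) (auto simp: l high_stays)
  have shift: "(doubling ^^ n) (z m) = z (n + m)" for n m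
    by (simp add: z_def funpow_add)
  show thesis
  proof (rule that)
    show "z (k + l) \<in> survivor a b"
      using gap z01[of "k + l"] by (intro survivorI) (auto simp: shift)
    show "(doubling ^^ n) (z (k + l)) \<in> {2 * b - 1..2 * a}" for n
      using low[of "l + n"] high[of "k + n"] by (simp add: shift ac_simps)
  qed
qed

lemma isCont_doubling: "x \<noteq> 1/2 \<Longrightarrow> isCont doubling x"
proof -
  assume "x \<noteq> 1/2"
  then consider "x < 1/2" | "1/2 < x" by linarith
  then show "isCont doubling x"
  proof cases
    case 1
    have "\<forall>\<^sub>F y in nhds x. doubling y = 2 * y"
      using eventually_nhds_in_open[of "{..<1/2}" x] 1
      by (auto elim!: eventually_mono simp: doubling_def)
    then show ?thesis
      by (subst isCont_cong) (auto intro: continuous_intros)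
  next
    case 2
    have "\<forall>\<^sub>F y in nhds x. doubling y = 2 * y - 1"
      using eventually_nhds_in_open[of "{1/2<..}" x] 2
      by (auto elim!: eventually_mono simp: doubling_def)
    then show ?thesis
      by (subst isCont_cong) (auto intro: continuous_intros)
  qed
qed

text \<open>Survivors chosen in the cores \<open>[2 * B n - 1, 2 * a]\<close> have a limit point
  away from the trivial survivors 0 and 1, and this limit point survives for
  \<open>b\<close>.\<close>

lemma survivor_nontrivial_limit:
  assumes ab: "0 < a" "a < 1/2" "1/2 < b" "b < 1"
    and B: "\<And>n. 1/2 < B n" "\<And>n. B n < 1" "B \<longlonglongrightarrow> b"
    and nontriv: "\<And>n. survivor a (B n) \<noteq> {0, 1}"
  shows "survivor a b \<noteq> {0, 1}"
proof -
  have "\<exists>y. y \<in> survivor a (B n) \<and> y \<in> {2 * B n - 1..2 * a}" for n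
  proof -
    obtain x where "x \<in> survivor a (B n)" "0 < x" "x < 1"
      using nontriv[of n] survivor_nontrivial_iff[of a "B n"] ab B(2)[of n] by auto
    then obtain y where "y \<in> survivor a (B n)" "\<And>m. (doubling ^^ m) y \<in> {2 * B n - 1..2 * a}"
      using survivor_enters_core[OF ab(1,2) B(1,2)] by blast
    from this(1) this(2)[of 0] show ?thesis by auto
  qed
  then obtain y where y: "\<And>n. y n \<in> survivor a (B n)" "\<And>n. y n \<in> {2 * B n - 1..2 * a}"
    by metis
  have "y n \<in> {0..1}" for n
    using y(1)[of n] by (auto simp: survivor_def)
  then obtain l g where g: "strict_mono (g :: nat \<Rightarrow> nat)" "(y \<circ> g) \<longlonglongrightarrow> l"
    using compact_Icc[of "0::real" 1] unfolding compact_def by metis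
  have Bg: "(\<lambda>n. B (g n)) \<longlonglongrightarrow> b"
    using LIMSEQ_subseq_LIMSEQ[OF B(3) g(1)] by (simp add: comp_def)
  have bounds: "2 * b - 1 \<le> l" "l \<le> 2 * a"
  proof -
    have "(\<lambda>n. 2 * B (g n) - 1) \<longlonglongrightarrow> 2 * b - 1"
      by (intro tendsto_intros Bg)
    then show "2 * b - 1 \<le> l"
      using LIMSEQ_le[OF _ g(2)] y(2) by (auto simp: comp_def)
    show "l \<le> 2 * a"
      using LIMSEQ_le_const2[OF g(2)] y(2) by (auto simp: comp_def)
  qed
  \<comment> \<open>A limit below \<open>b\<close> is below some \<open>c < b\<close>. Eventually
    the orbit points are below \<open>c\<close> and \<open>c\<close> is below
    \<open>B (g n)\<close>, which forces them to the left of the hole.\<close>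
  have avoid: "L \<le> a \<or> b \<le> L"
    if L: "(\<lambda>n. (doubling ^^ k) (y (g n))) \<longlonglongrightarrow> L" for k L
  proof (rule disjCI)
    assume "\<not> b \<le> L"
    then obtain c where c: "L < c" "c < b"
      using dense[of L b] by auto
    have "\<forall>\<^sub>F n in sequentially. (doubling ^^ k) (y (g n)) \<le> a"
      using order_tendstoD(2)[OF L c(1)] order_tendstoD(1)[OF Bg c(2)]
    proof eventually_elim
      case (elim n)
      have "(doubling ^^ k) (y (g n)) \<notin> {a<..<B (g n)}"
        using y(1)[of "g n"] by (simp add: survivor_def)
      with elim show ?case by auto
    qed
    then show "L \<le> a"
      using L by (intro tendsto_upperbound[OF L]) auto
  qed
  have conv: "(\<lambda>n. (doubling ^^ k) (y (g n))) \<longlonglongrightarrow> (doubling ^^ k) l" for k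
  proof (induction k)
    case 0
    then show ?case using g(2) by (simp add: comp_def)
  next
    case (Suc k)
    \<comment> \<open>The discontinuity 1/2 lies inside the hole, which the limit orbit has avoided
      up to time \<open>k\<close>.\<close>
    have "(doubling ^^ k) l \<noteq> 1/2"
      using avoid[OF Suc] ab by auto
    then show ?case
      using isCont_tendsto_compose[OF isCont_doubling Suc] by simp
  qed
  have "l \<in> survivor a b"
    using avoid[OF conv] bounds ab by (intro survivorI) auto
  then show ?thesis
    using bounds ab survivor_nontrivial_iff[of a b] by force
qed

section \<open>The value of phi on Delta(r)\<close>

context rotation
begin

text \<open>The orbit consists of points \<open>h i\<close> with \<open>0 \<le> i < q\<close>, and
  the neighbours \<open>q - p - 1\<close> and \<open>q - p\<close> lie on either side of the
  hole.\<close>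

lemma survivor_upper_orbit:
  assumes "0 \<le> a" "h (q - p - 1) \<le> a"
  shows "survivor a (h (q - p)) \<noteq> {0, 1}"
proof -
  have "h (q - p) \<in> survivor a (h (q - p))"
  proof -
    have "(doubling ^^ k) (h (q - p)) \<notin> {a<..<h (q - p)}" for k
    proof -
      let ?i = "(q - p + int k * p) mod q"
      have "(doubling ^^ k) (h (q - p)) = h ?i"
        using doubling_orbit_h[of "q - p" k] p_pos p_less by simp
      moreover have "h ?i \<le> h (q - p - 1) \<or> h (q - p) \<le> h ?i"
        using h_mono[of ?i "q - p - 1"] h_mono[of "q - p" ?i] by linarith
      ultimately show ?thesis using assms by auto
    qed
    then show ?thesis
      using h_complement h_0_pos h_0_less_1 by (simp add: survivor_def)
  qed
  moreover have "0 < h (q - p)" "h (q - p) < 1"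
    using h_complement h_0_pos h_0_less_1 by linarith+
  ultimately show ?thesis
    using survivor_nontrivial_iff[of a "h (q - p)"] assms(1) by fastforce
qed

text \<open>If \<open>b\<close> exceeded \<open>h (q - p)\<close>, then \<open>h_complement\<close>
  would give \<open>2 * b - 1 > h 0\<close> and \<open>2 * a \<le> h 0 + 1/2\<close>. The core would
  lie in the half-circle that no orbit can stay in.\<close>

lemma survivor_nontrivial_imp_le:
  assumes ab: "0 < a" "a < 1/2" "b < 1" and a_le: "a \<le> h (q - p) - 1/4"
    and nontriv: "survivor a b \<noteq> {0, 1}"
  shows "b \<le> h (q - p)"
proof (rule ccontr)
  assume "\<not> b \<le> h (q - p)"
  then have b: "h (q - p) < b" by simp
  then have "1/2 < b"
    using h_complement h_0_pos by linarith
  obtain x where x: "x \<in> survivor a b" "0 < x" "x < 1"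
    using nontriv survivor_nontrivial_iff[of a b] ab by auto
  obtain y where y: "y \<in> survivor a b" "\<And>n. (doubling ^^ n) y \<in> {2 * b - 1..2 * a}"
    using survivor_enters_core[OF ab(1,2) \<open>1/2 < b\<close> ab(3) x] by blast
  show False
  proof (rule no_orbit_in_half_circle)
    fix k
    show "(doubling ^^ Suc k) y
      = 2 * (doubling ^^ k) y - real_of_int (if (doubling ^^ k) y \<le> 1/2 then 0 else 1)"
      by (simp add: doubling_def)
    show "h 0 < (doubling ^^ k) y"
      using y(2)[of k] b h_complement by auto
    show "(doubling ^^ k) y \<le> h 0 + 1/2"
      using y(2)[of k] a_le h_complement by auto
  qed
qed

lemma phi_eq:
  assumes "0 < a" "a < 1/2" "h (q - p - 1) \<le> a" "a \<le> h (q - p) - 1/4"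
  shows "phi a = h (q - p)"
  unfolding phi_def
proof (rule cSup_eq_maximum)
  show "h (q - p) \<in> {b. a < b \<and> b < 1 \<and> survivor a b \<noteq> {0, 1}}"
    using survivor_upper_orbit[of a] h_complement h_0_pos h_0_less_1 assms by auto
qed (use survivor_nontrivial_imp_le assms in auto)

end

lemma phi_eq_word_val:
  assumes a: "0 < a" "a < 1/2" and r: "0 < r" "r < 1" "a \<in> Delta r"
  shows "phi a = word_val (cycle (omega_plus r))"
proof -
  obtain p q where pq: "quotient_of r = (p, q)"
    by fastforce
  have q: "0 < q"
    using quotient_of_denom_pos[OF pq] .
  have "r = of_int p / of_int q"
    using quotient_of_div[OF pq] .
  then have "0 < rat_of_int p / rat_of_int q" "rat_of_int p / rat_of_int q < 1"
    using r(1,2) by simp_all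
  then have "0 < p" "p < q"
    using q by (simp_all add: zero_less_divide_iff divide_less_eq_1)
  then interpret rotation p q
    using quotient_of_coprime[OF pq] by unfold_locales
  show ?thesis
    using phi_eq[OF a] r(3)
    by (simp add: Delta_def omega_minus_eq[OF pq] omega_plus_eq[OF pq]
      word_val_cycle_upper word_val_cycle_lower word_val_preperiodic)
qed

section \<open>Attainment of the supremum\<close>

lemma le_phi_iff:
  assumes a: "0 < a" "a < 1/2" and b: "1/2 < b" "b < 1"
  shows "survivor a b \<noteq> {0, 1} \<longleftrightarrow> b \<le> phi a"
proof
  let ?S = "{b. a < b \<and> b < 1 \<and> survivor a b \<noteq> {0, 1}}"
  have bdd: "bdd_above ?S"
    by (rule bdd_aboveI[of _ 1]) auto
  {
    assume "survivor a b \<noteq> {0, 1}"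
    with a b have "b \<in> ?S" by simp
    then show "b \<le> phi a"
      unfolding phi_def using bdd by (rule cSup_upper)
  }
  assume "b \<le> phi a"
  \<comment> \<open>The point 1/2 is an endpoint of the hole \<open>(a, 1/2)\<close> and maps to the
    fixed point 1.\<close>
  have "?S \<noteq> {}"
  proof -
    have "(doubling ^^ n) (1/2) \<notin> {a<..<1/2}" for n
    proof (cases n)
      case (Suc m)
      have "(doubling ^^ m) 1 = 1"
        by (induction m) (auto simp: doubling_1)
      with Suc show ?thesis
        by (simp add: funpow_Suc_right doubling_def del: funpow.simps)
    qed simp
    then have "1/2 \<in> survivor a (1/2)"
      by (simp add: survivor_def)
    then have "1/2 \<in> ?S"
      using a by auto
    then show ?thesis by blast
  qed
  have ex: "\<exists>b'\<in>?S. c < b'" if "c < b" for c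
  proof -
    have "c < Sup ?S"
      using that \<open>b \<le> phi a\<close> unfolding phi_def by linarith
    then show ?thesis
      by (rule iffD1[OF less_cSup_iff[OF \<open>?S \<noteq> {}\<close> bdd]])
  qed
  \<comment> \<open>Starts at the midpoint of 1/2 and \<open>b\<close> and increases to
    \<open>b\<close>, so every hole \<open>(a, B n)\<close> still contains 1/2, as the limit
    argument requires.\<close>
  define B where "B n = b - (b - 1/2) / 2 * inverse (real (Suc n))" for n
  have B: "1/2 < B n" "B n < b" for n
  proof -
    define X where "X = (b - 1/2) / 2 * inverse (real (Suc n))"
    have "inverse (real (Suc n)) \<le> 1" "0 < inverse (real (Suc n))"
      by (auto simp: field_simps)
    then have "X \<le> (b - 1/2) / 2" "0 < X"
      using b unfolding X_def by (auto intro!: mult_left_le mult_pos_pos)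
    moreover have "B n = b - X"
      by (simp only: B_def X_def)
    ultimately show "1/2 < B n" "B n < b"
      using b by auto
  qed
  have "B \<longlonglongrightarrow> b"
    unfolding B_def
    using tendsto_diff[OF tendsto_const[of b]
      tendsto_mult_right_zero[OF LIMSEQ_inverse_real_of_nat, of "(b - 1/2) / 2"]]
    unfolding diff_zero .
  moreover have "survivor a (B n) \<noteq> {0, 1}" for n
  proof -
    obtain b' where "b' \<in> ?S" "B n < b'"
      using ex[OF B(2)] by blast
    then show ?thesis
      using survivor_nontrivial_antimono[of a "B n" b'] a by simp
  qed
  moreover have "B n < 1" for n
    using B(2)[of n] b by simp
  ultimately show "survivor a b \<noteq> {0, 1}"
    using survivor_nontrivial_limit[OF a b, of B] B(1) by blast
qed

theorem theorem2p7:
  "(\<forall>a \<in> {1/4<..<1/2}. \<forall>r::rat. 0 < r \<and> r < 1 \<and> a \<in> Delta r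
       \<longrightarrow> phi a = word_val (cycle (omega_plus r))) \<and>
   D0 = {(a, b) \<in> {1/4<..<1/2} \<times> {1/2<..<3/4}. b \<le> phi a}"
proof -
  have "phi a = word_val (cycle (omega_plus r))"
    if "a \<in> {1/4<..<1/2}" "0 < r" "r < 1" "a \<in> Delta r" for a and r :: rat
    using that phi_eq_word_val[of a r] by simp
  moreover have "survivor a b \<noteq> {0, 1} \<longleftrightarrow> b \<le> phi a"
    if "a \<in> {1/4<..<1/2}" "b \<in> {1/2<..<3/4}" for a b
    using that le_phi_iff[of a b] by simp
  then have "D0 = {(a, b) \<in> {1/4<..<1/2} \<times> {1/2<..<3/4}. b \<le> phi a}"
    unfolding D0_def by auto
  ultimately show ?thesis by blast
qed

end
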